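(* Let $(S,* )$ be an infinite commutative weakly cancellative and root-finite semigroup with identity $\varepsilon$, let $\theta:(S,* )\to(\mathbb{N},\cdot)$ be a homomorphism, and let $*_\theta$ be the induced exponential-like operation on $S$. Then for every finite coloring $S=C_1\cup\ldots\cup C_r$, for every $N\in\mathbb{N}$, and for every sequence $\Phi=(f_n\mid n\ge 2)$ of functions $f_n:S^{n-1}\to\mathbb{N}$, there exist a one-to-one sequence $(a_n)_{n\in\mathbb{N}}$ in $S$ and an index $i\in\{1,\ldots,r\}$ such that $\mathrm{FE}_{\theta,N,\Phi}(a_n)_{n=1}^\infty\subseteq C_i$.
   Context: $\mathbb{N}$ denotes the set of positive integers. A finite coloring of $S$ is a finite partition of $S$. A commutative semigroup $(S,* )$ is weakly cancellative if for all $a,b\in S$ the set $\{x\in S\mid a*x=b\}$ is finite. A semigroup $(S,* )$ is root-finite if for every $a\in S$ and every $k\in\mathbb{N}$ the set $\{x\in S\mid x^k=a\}$ is finite, where $x^k$ is the $k$-fold $*$-product of $x$ with itself. Additive notation: for $x_1,\ldots,x_n\in S$, $\sum_{i=1}^n x_i$ denotes $x_1*\cdots*x_n$ (an empty sum is $\varepsilon$); for $\lambda\in\mathbb{N}$ and $x\in S$, $\lambda x$ denotes $x*\cdots*x$ ($\lambda$ times), and $0x=\varepsilon$. The exponential-like operation $*_\theta$ on $S$ induced by a homomorphism $\theta:(S,* )\to(\mathbb{N},\cdot)$ is $a*_\theta b=\theta(a)\,b=b*\cdots*b$ ($\theta(a)$ times). For a sequence $(a_n)_{n\in\mathbb{N}}$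 in $S$, $N\in\mathbb{N}$ and $\Phi=(f_n\mid n\ge2)$ with $f_n:S^{n-1}\to\mathbb{N}$, define $\mathrm{EXP}_{\theta,N,\Phi}(a_1)=\{a_1\}$ and, for $k\ge2$, $$\mathrm{EXP}_{\theta,N,\Phi}(a_1,\ldots,a_k)=\left\{\left(\sum_{t=1}^{k-1}\lambda_t a_t\right)*_\theta a_k\ \Big|\ 0\le\lambda_1\le N,\ 0\le\lambda_t\le f_t(a_1,\ldots,a_{t-1})\text{ for }2\le t\le k-1\right\},$$ where the $\lambda_t$ are integers, and $\mathrm{FE}_{\theta,N,\Phi}(a_n)_{n=1}^\infty=\bigcup_{k=1}^\infty\mathrm{EXP}_{\theta,N,\Phi}(a_1,\ldots,a_k)$. *)

theory Defs
  imports "HOL-Library.Disjoint_Sets"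
begin

text \<open>
  The semigroup \<open>S\<close> is the type \<open>'a\<close>, written multiplicatively: \<open>\<epsilon>\<close> is \<open>1\<close>, \<open>\<lambda>x\<close> is \<open>x ^ \<lambda>\<close>,
  and \<open>\<Sum>\<^sub>t \<lambda>\<^sub>t a\<^sub>t\<close> is \<open>\<Prod>t. a t ^ \<lambda> t\<close>.  Positive integers are positive elements of
  \<^typ>\<open>nat\<close>.
\<close>

definition weakly_cancellative :: "('a \<Rightarrow> 'a \<Rightarrow> 'a) \<Rightarrow> bool" where
  "weakly_cancellative f \<longleftrightarrow> (\<forall>a b. finite {x. f a x = b})"

definition root_finite :: "'a::comm_monoid_mult itself \<Rightarrow> bool" where
  "root_finite _ \<longleftrightarrow> (\<forall>(a::'a) (k::nat). k > 0 \<longrightarrow> finite {x. x ^ k = a})"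

definition hom_to_pos_nat :: "('a::comm_monoid_mult \<Rightarrow> nat) \<Rightarrow> bool" where
  "hom_to_pos_nat \<theta> \<longleftrightarrow> (\<forall>a. \<theta> a > 0) \<and> (\<forall>a b. \<theta> (a * b) = \<theta> a * \<theta> b)"

definition exp_op :: "('a::comm_monoid_mult \<Rightarrow> nat) \<Rightarrow> 'a \<Rightarrow> 'a \<Rightarrow> 'a" where
  "exp_op \<theta> a b = b ^ \<theta> a"

text \<open>
  Sequences are indexed from 1 (the value \<open>a 0\<close> is never used), and \<open>EXP \<theta> N f a k\<close> stands for
  the set of \<open>(a\<^sub>1, \<dots>, a\<^sub>k)\<close>, meaningful for \<open>k \<ge> 1\<close>.  The function \<open>f\<^sub>n : S\<^sup>n\<^sup>-\<^sup>1 \<rightarrow> \<nat>\<close> is \<open>f n\<close>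
  restricted to lists of length \<open>n - 1\<close>; note that \<open>map a [1..<t]\<close> is \<open>[a\<^sub>1, \<dots>, a\<^sub>t\<^sub>-\<^sub>1]\<close>.
\<close>

definition EXP ::
  "('a::comm_monoid_mult \<Rightarrow> nat) \<Rightarrow> nat \<Rightarrow> (nat \<Rightarrow> 'a list \<Rightarrow> nat) \<Rightarrow> (nat \<Rightarrow> 'a) \<Rightarrow> nat \<Rightarrow> 'a set" where
  "EXP \<theta> N f a k =
     (if k = 1 then {a 1}
      else {exp_op \<theta> (\<Prod>t=1..k-1. a t ^ l t) (a k) | l :: nat \<Rightarrow> nat.
              l 1 \<le> N \<and> (\<forall>t\<in>{2..k-1}. l t \<le> f t (map a [1..<t]))})"

definition FE ::
  "('a::comm_monoid_mult \<Rightarrow> nat) \<Rightarrow> nat \<Rightarrow> (nat \<Rightarrow> 'a list \<Rightarrow> nat) \<Rightarrow> (nat \<Rightarrow> 'a) \<Rightarrow> 'a set" where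
  "FE \<theta> N f a = (\<Union>k\<in>{1..}. EXP \<theta> N f a k)"

end

theory Submission
  imports Defs
begin

text \<open>
  Write \<open>E\<^sub>x z = exp_op \<theta> x z\<close>.  Since \<open>\<theta>\<close> is a homomorphism, \<open>E\<^sub>x\<^sub>y = E\<^sub>x E\<^sub>y\<close>: the monoid acts
  on itself by power maps.  Suppose that a class \<open>A\<close> of subsets has this recurrence property:
  if \<open>A\<close> belongs to the class, then for every \<open>L\<close> there are infinitely many \<open>b \<in> A\<close> for which
  \<open>A' = {z. \<forall>l \<le> L. E\<^bsub>b^l\<^esub> z \<in> A}\<close> again belongs to it.  Starting from a colour in the class and
  picking such elements one after another, each from the set that the previous step has left,
  gives the sequence: an element that lies in the \<open>k\<close>-th set is carried into the
  colour by every admissible product of its predecessors.  The bound on the exponents of \<open>a\<^sub>k\<close>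
  depends only on the earlier terms, so it is known when \<open>a\<^sub>k\<close> is chosen.

  The class used here is that of the \<^emph>\<open>piecewise syndetic\<close> sets for the action \<open>E\<close>, where the
  usual ``nonempty'' in the notion of a thick set is replaced by ``rich''.  A set is rich if van
  der Waerden's theorem for progressions \<open>a, ab, \<dots>, ab\<^sup>L\<close> holds with the difference \<open>b\<close> taken from
  the set, outside any prescribed finite set.  Four facts carry the argument.
  \<^item> Richness is partition regular (\<open>rich_Un\<close>, by a product colouring), and a set is rich if its
    preimage under some \<open>E\<^sub>s\<close> is (\<open>rich_of_preimage\<close>).
  \<^item> The whole monoid is rich (\<open>rich_UNIV\<close>): root-finiteness gives a \<open>z\<close> whose first \<open>W\<close> powers
    avoid a given finite set, and van der Waerden's theorem applies to its exponents.
  \<^item> If finitely many sets cover a thick set, one of them is piecewise syndetic (\<open>thick_UN\<close>).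
    Hence some colour is piecewise syndetic.
  \<^item> Piecewise syndetic sets are rich, so they supply their own differences.  Applying richness
    to the colouring of \<open>g\<close> by some \<open>s\<close> for which \<open>E\<^sub>s E\<^sub>g z \<in> A\<close> yields the recurrence property
    (\<open>piecewise_syndetic_recurrence\<close>).
\<close>

section \<open>Van der Waerden's theorem\<close>

text \<open>
  The bound \<open>d \<le> W\<close> matters for \<open>L = 0\<close>, where \<open>a + L * d \<le> W\<close> says nothing about \<open>d\<close>.
\<close>

definition vdw_bound :: "nat \<Rightarrow> nat \<Rightarrow> nat \<Rightarrow> bool" where
  "vdw_bound L k W \<longleftrightarrow> (\<forall>\<chi>::nat \<Rightarrow> nat. (\<forall>n. \<chi> n < k) \<longrightarrow>
     (\<exists>a d. 0 < d \<and> a + L * d \<le> W \<and> d \<le> W \<and> (\<forall>l\<le>L. \<chi> (a + l * d) = \<chi> a)))"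

text \<open>
  The \<open>m\<close> progressions with differences \<open>D i\<close> that start from the common point \<open>e\<close> are
  monochromatic apart from \<open>e\<close> itself, in pairwise distinct colours: a colour-focused family in
  the sense of the standard proof of van der Waerden's theorem, with the focus on the left.
\<close>

definition focused :: "nat \<Rightarrow> nat \<Rightarrow> (nat \<Rightarrow> nat) \<Rightarrow> nat \<Rightarrow> nat \<Rightarrow> (nat \<Rightarrow> nat) \<Rightarrow> bool" where
  "focused L W \<chi> m e D \<longleftrightarrow> e \<le> W \<and> inj_on (\<lambda>i. \<chi> (e + D i)) {..<m} \<and>
     (\<forall>i<m. 0 < D i \<and> e + Suc L * D i \<le> W \<and>
        (\<forall>l\<in>{1..Suc L}. \<chi> (e + l * D i) = \<chi> (e + D i)))"

text \<open>
  The pattern of \<open>\<chi>\<close> on the \<open>W + 1\<close> points from \<open>n\<close> on takes finitely many values, so it can be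
  used as a colour of \<open>n\<close>.
\<close>

lemma block_colouring:
  fixes k W :: nat
  obtains enc :: "(nat \<Rightarrow> nat) \<Rightarrow> nat \<Rightarrow> nat" and K :: nat
  where "\<And>\<chi> n. (\<forall>n. \<chi> n < k) \<Longrightarrow> enc \<chi> n < K"
    and "\<And>\<chi> m n j. (\<forall>n. \<chi> n < k) \<Longrightarrow> enc \<chi> m = enc \<chi> n \<Longrightarrow> j \<le> W \<Longrightarrow> \<chi> (m + j) = \<chi> (n + j)"
proof -
  let ?B = "{xs. set xs \<subseteq> {..<k} \<and> length xs = Suc W}"
  have "finite ?B" by (rule finite_lists_length_eq) simp
  then obtain h where h: "bij_betw h ?B {0..<card ?B}"
    using ex_bij_betw_finite_nat by blast
  define blk where "blk \<chi> n = map (\<lambda>j. \<chi> (n + j)) [0..<Suc W]" for \<chi> :: "nat \<Rightarrow> nat" and n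
  have blk: "blk \<chi> n \<in> ?B" if "\<forall>n. \<chi> n < k" for \<chi> n
    using that by (auto simp: blk_def)
  show thesis
  proof (rule that[of "\<lambda>\<chi> n. h (blk \<chi> n)" "card ?B"])
    show "h (blk \<chi> n) < card ?B" if "\<forall>n. \<chi> n < k" for \<chi> n
      using bij_betwE[OF h] blk[OF that, of n] by auto
    show "\<chi> (m + j) = \<chi> (n + j)"
      if c: "\<forall>n. \<chi> n < k" and "h (blk \<chi> m) = h (blk \<chi> n)" and "j \<le> W" for \<chi> m n j
    proof -
      have "blk \<chi> m = blk \<chi> n"
        using inj_onD[OF bij_betw_imp_inj_on[OF h] that(2) blk[OF c] blk[OF c]] .
      then have "blk \<chi> m ! j = blk \<chi> n ! j" by simp
      then show ?thesis using \<open>j \<le> W\<close> by (simp add: blk_def del: upt_Suc)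
    qed
  qed
qed

text \<open>
  One more colour is gained by colouring each point with the pattern on the block that starts
  there and taking a progression of \<open>L + 1\<close> equal blocks.  Inside a block there is a focused family
  of \<open>m\<close> progressions.  If its focus has one of their colours, that progression becomes longer.
  Otherwise moving to the next block while moving along a progression gives \<open>m\<close> progressions,
  the copies of the focus give one more, and all of them point to the same new focus, one
  block step to the left.
\<close>

lemma focusing:
  assumes IH: "\<And>k. \<exists>W. vdw_bound L k W"
  shows "\<exists>W. \<forall>\<chi>. (\<forall>n. \<chi> n < k) \<longrightarrow>
     (\<exists>a d. 0 < d \<and> a + Suc L * d \<le> W \<and> (\<forall>l\<le>Suc L. \<chi> (a + l * d) = \<chi> a))
     \<or> (\<exists>e D. focused L W \<chi> m e D)"
proof (induction m)
  case 0
  show ?case by (rule exI[of _ 0]) (auto simp: focused_def)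
next
  case (Suc m)
  then obtain W where W: "\<And>\<chi>. (\<forall>n. \<chi> n < k) \<Longrightarrow>
     (\<exists>a d. 0 < d \<and> a + Suc L * d \<le> W \<and> (\<forall>l\<le>Suc L. \<chi> (a + l * d) = \<chi> a))
     \<or> (\<exists>e D. focused L W \<chi> m e D)" by blast
  obtain enc K where enc: "\<And>\<chi> n. (\<forall>n. \<chi> n < k) \<Longrightarrow> enc \<chi> n < (K::nat)"
    and enc_eq: "\<And>\<chi> m n j. (\<forall>n. \<chi> n < k) \<Longrightarrow> enc \<chi> m = enc \<chi> n \<Longrightarrow> j \<le> W \<Longrightarrow> \<chi> (m + j) = \<chi> (n + j)"
    using block_colouring[of k W] by metis
  obtain V where V: "vdw_bound L K V" using IH by blast
  let ?W = "2 * V + W"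
  show ?case
  proof (intro exI[of _ ?W] allI impI)
    fix \<chi> :: "nat \<Rightarrow> nat" assume \<chi>: "\<forall>n. \<chi> n < k"
    obtain a d where d: "0 < d" "a + L * d \<le> V" "d \<le> V"
      and ad: "\<And>l. l \<le> L \<Longrightarrow> enc \<chi> (a + l * d + V) = enc \<chi> (a + V)"
      using V[unfolded vdw_bound_def, rule_format, of "\<lambda>n. enc \<chi> (n + V)"] enc[OF \<chi>] by auto
    define a0 where "a0 = a + V - d"
    have a0: "a0 + d = a + V" using d by (simp add: a0_def)
    have a0V: "a0 + Suc L * d \<le> 2 * V" using d a0 by simp
    \<comment> \<open>The colouring looks the same, for \<open>W + 1\<close> steps, from each of the points
      \<open>a0 + d, \<dots>, a0 + (L + 1) d\<close>; the room of \<open>V\<close> to the left of \<open>a\<close> makes \<open>a0\<close> available.\<close>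
    have rep: "\<chi> (a0 + l * d + j) = \<chi> (a0 + d + j)" if l: "l \<in> {1..Suc L}" and j: "j \<le> W" for l j
    proof -
      obtain l' where l': "l = Suc l'" "l' \<le> L" using l by (cases l) auto
      have "a0 + l * d = a + l' * d + V" using a0 l' by simp
      then show ?thesis using enc_eq[OF \<chi> ad[OF l'(2)] j] a0 by simp
    qed
    define \<psi> where "\<psi> j = \<chi> (a0 + d + j)" for j
    have \<psi>: "\<forall>n. \<psi> n < k" using \<chi> by (simp add: \<psi>_def)
    show "(\<exists>a d. 0 < d \<and> a + Suc L * d \<le> ?W \<and> (\<forall>l\<le>Suc L. \<chi> (a + l * d) = \<chi> a))
      \<or> (\<exists>e D. focused L ?W \<chi> (Suc m) e D)"
      using W[OF \<psi>]
    proof (elim disjE exE conjE)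
      fix b g assume b: "0 < g" "b + Suc L * g \<le> W" "\<forall>l\<le>Suc L. \<psi> (b + l * g) = \<psi> b"
      have "a0 + d + b + Suc L * g \<le> ?W" using a0V b(2) by simp
      moreover have "\<forall>l\<le>Suc L. \<chi> (a0 + d + b + l * g) = \<chi> (a0 + d + b)"
        using b(3) by (simp add: \<psi>_def add.assoc)
      ultimately show ?thesis using b(1) by blast
    next
      fix e D assume "focused L W \<psi> m e D"
      then have e: "e \<le> W" and inj: "inj_on (\<lambda>i. \<psi> (e + D i)) {..<m}"
        and D: "\<And>i. i < m \<Longrightarrow> 0 < D i" "\<And>i. i < m \<Longrightarrow> e + Suc L * D i \<le> W"
          "\<And>i l. i < m \<Longrightarrow> l \<in> {1..Suc L} \<Longrightarrow> \<psi> (e + l * D i) = \<psi> (e + D i)"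
        unfolding focused_def by blast+
      show ?thesis
      proof (cases "\<exists>i<m. \<psi> (e + D i) = \<psi> e")
        case True
        then obtain i where i: "i < m" "\<psi> (e + D i) = \<psi> e" by blast
        have "\<psi> (e + l * D i) = \<psi> e" if "l \<le> Suc L" for l
          using D(3)[OF i(1), of l] i(2) that by (cases "l = 0") auto
        then have "\<forall>l\<le>Suc L. \<chi> (a0 + d + e + l * D i) = \<chi> (a0 + d + e)"
          by (simp add: \<psi>_def add.assoc)
        moreover have "a0 + d + e + Suc L * D i \<le> ?W" using a0V D(2)[OF i(1)] by simp
        ultimately show ?thesis using D(1)[OF i(1)] by blast
      next
        case False
        define D' where "D' i = (if i < m then d + D i else d)" for i
        have le: "e + l * D i \<le> W" if "i < m" "l \<in> {1..Suc L}" for i l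
        proof -
          have "l * D i \<le> Suc L * D i" using that by (intro mult_le_mono1) auto
          then show ?thesis using D(2)[OF that(1)] by linarith
        qed
        have col: "\<chi> (a0 + e + l * D' i) = (if i < m then \<psi> (e + D i) else \<psi> e)"
          if l: "l \<in> {1..Suc L}" for l i
        proof (cases "i < m")
          case True
          have "a0 + e + l * D' i = a0 + l * d + (e + l * D i)"
            using True by (simp add: D'_def algebra_simps)
          then show ?thesis
            using rep[OF l le[OF True l]] D(3)[OF True l] True by (simp only: \<psi>_def if_True)
        next
          case False
          have "a0 + e + l * D' i = a0 + l * d + e" using False by (simp add: D'_def)
          then show ?thesis using rep[OF l e] False by (simp only: \<psi>_def if_False)
        qed
        have col1: "\<chi> (a0 + e + D' i) = (if i < m then \<psi> (e + D i) else \<psi> e)" for i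
          using col[of 1 i] by simp
        have "inj_on (\<lambda>i. \<chi> (a0 + e + D' i)) {..<Suc m}"
          unfolding col1 using inj False by (auto simp: inj_on_def less_Suc_eq)
        moreover have "a0 + e \<le> ?W" using a0V e by simp
        moreover have "0 < D' i" for i using d by (simp add: D'_def)
        moreover have "a0 + e + Suc L * D' i \<le> ?W" if "i < Suc m" for i
        proof (cases "i < m")
          case True
          then have "Suc L * D' i = Suc L * d + Suc L * D i"
            by (simp add: D'_def algebra_simps)
          then show ?thesis using D(2)[OF True] a0V by linarith
        next
          case False
          then show ?thesis using e a0V by (simp add: D'_def)
        qed
        ultimately have "focused L ?W \<chi> (Suc m) (a0 + e) D'"
          unfolding focused_def using col col1 by auto
        then show ?thesis by blast
      qed
    qed
  qed
qed

text \<open>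
  In a focused family of \<open>k\<close> progressions all \<open>k\<close> colours occur, so the focus has the colour of
  one of the progressions and extends it.
\<close>

theorem van_der_Waerden: "\<exists>W. vdw_bound L k W"
proof (induction L arbitrary: k)
  case 0
  show ?case by (rule exI[of _ 1]) (auto simp: vdw_bound_def)
next
  case (Suc L)
  obtain W where W: "\<And>\<chi>. (\<forall>n. \<chi> n < k) \<Longrightarrow>
     (\<exists>a d. 0 < d \<and> a + Suc L * d \<le> W \<and> (\<forall>l\<le>Suc L. \<chi> (a + l * d) = \<chi> a))
     \<or> (\<exists>e D. focused L W \<chi> k e D)"
    using focusing[OF Suc, of k k] by blast
  have "vdw_bound (Suc L) k W"
    unfolding vdw_bound_def
  proof (intro allI impI)
    fix \<chi> :: "nat \<Rightarrow> nat" assume \<chi>: "\<forall>n. \<chi> n < k"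
    have "\<exists>a d. 0 < d \<and> a + Suc L * d \<le> W \<and> (\<forall>l\<le>Suc L. \<chi> (a + l * d) = \<chi> a)"
      using W[OF \<chi>]
    proof (elim disjE exE)
      fix e D assume "focused L W \<chi> k e D"
      then have inj: "inj_on (\<lambda>i. \<chi> (e + D i)) {..<k}"
        and D: "\<And>i. i < k \<Longrightarrow> 0 < D i" "\<And>i. i < k \<Longrightarrow> e + Suc L * D i \<le> W"
          "\<And>i l. i < k \<Longrightarrow> l \<in> {1..Suc L} \<Longrightarrow> \<chi> (e + l * D i) = \<chi> (e + D i)"
        unfolding focused_def by blast+
      have "(\<lambda>i. \<chi> (e + D i)) ` {..<k} = {..<k}"
        using inj \<chi> by (intro endo_inj_surj) auto
      then have "\<chi> e \<in> (\<lambda>i. \<chi> (e + D i)) ` {..<k}" using \<chi> by simp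
      then obtain i where i: "i < k" "\<chi> (e + D i) = \<chi> e" by auto
      have "\<chi> (e + l * D i) = \<chi> e" if "l \<le> Suc L" for l
        using D(3)[OF i(1), of l] i(2) that by (cases "l = 0") auto
      then show ?thesis using D(1,2)[OF i(1)] by blast
    qed blast
    then obtain a d where ad: "0 < d" "a + Suc L * d \<le> W" "\<forall>l\<le>Suc L. \<chi> (a + l * d) = \<chi> a"
      by blast
    moreover have "d \<le> W" using ad(2) by simp
    ultimately show "\<exists>a d. 0 < d \<and> a + Suc L * d \<le> W \<and> d \<le> W \<and> (\<forall>l\<le>Suc L. \<chi> (a + l * d) = \<chi> a)"
      by blast
  qed
  then show ?case by blast
qed

section \<open>Sets of differences of monochromatic progressions\<close>

text \<open>
  Both the base point and the difference are taken from a set \<open>G\<close>, so that for finite \<open>G\<close> the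
  statement is a finitary one: the colouring matters at finitely many points only.
\<close>

definition mono_progression :: "('a::comm_monoid_mult \<Rightarrow> nat) \<Rightarrow> 'a set \<Rightarrow> 'a set \<Rightarrow> nat \<Rightarrow> bool" where
  "mono_progression \<chi> G D L \<longleftrightarrow> (\<exists>a\<in>G. \<exists>b\<in>G \<inter> D. \<forall>l\<le>L. \<chi> (a * b ^ l) = \<chi> a)"

text \<open>
  Without the finite set \<open>X\<close> of forbidden differences every set that contains \<open>1\<close> would qualify;
  with it, a rich set offers infinitely many differences, as a one-to-one sequence needs.  The finite set \<open>G\<close> is
  chosen before the colouring, which spares a compactness argument later on.
\<close>

definition rich :: "'a::comm_monoid_mult set \<Rightarrow> bool" where
  "rich A \<longleftrightarrow> (\<forall>X k L. finite X \<longrightarrow> (\<exists>G. finite G \<and>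
     (\<forall>\<chi>. (\<forall>x. \<chi> x < k) \<longrightarrow> mono_progression \<chi> G (A - X) L)))"

lemma richD:
  assumes "rich A" "finite X"
  obtains G where "finite G"
    "\<And>\<chi>. (\<forall>x. \<chi> x < k) \<Longrightarrow> mono_progression \<chi> G (A - X) L"
  using assms(1)[unfolded rich_def, rule_format, OF assms(2), of k L]
  by (elim exE conjE) (rule that, assumption, iprover)

lemma rich_mono:
  fixes A B :: "'a::comm_monoid_mult set"
  assumes "rich A" "A \<subseteq> B"
  shows "rich B"
proof -
  have mono: "mono_progression \<chi> G (B - X) L" if "mono_progression \<chi> G (A - X) L" for \<chi> G X L
    using that assms(2) unfolding mono_progression_def by blast
  show ?thesis
    unfolding rich_def
  proof (intro allI impI)
    fix X :: "'a set" and k L :: nat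
    assume X: "finite X"
    obtain G where "finite G"
      and G: "\<And>\<chi>. (\<forall>x. \<chi> x < k) \<Longrightarrow> mono_progression \<chi> G (A - X) L"
      using richD[OF assms(1) X, of k L] by blast
    then show "\<exists>G. finite G \<and> (\<forall>\<chi>. (\<forall>x. \<chi> x < k) \<longrightarrow> mono_progression \<chi> G (B - X) L)"
      by (intro exI[of _ G]) (simp add: mono)
  qed
qed

lemma not_rich_empty: "\<not> rich ({} :: 'a::comm_monoid_mult set)"
proof
  assume "rich ({} :: 'a set)"
  then obtain G :: "'a set" where
    G: "\<And>\<chi>. (\<forall>x. \<chi> x < 1) \<Longrightarrow> mono_progression \<chi> G ({} - {}) 0"
    using richD[of "{}" "{}" 1 0] by blast
  show False using G[of "\<lambda>_. 0"] by (simp add: mono_progression_def)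
qed

lemma not_richE:
  assumes "\<not> rich A"
  obtains X k L where "finite X"
    "\<And>G. finite G \<Longrightarrow> \<exists>\<chi>. (\<forall>x. \<chi> x < k) \<and> \<not> mono_progression \<chi> G (A - X) L"
proof -
  obtain X k L where *: "finite X"
    "\<not> (\<exists>G. finite G \<and> (\<forall>\<chi>. (\<forall>x. \<chi> x < k) \<longrightarrow> mono_progression \<chi> G (A - X) L))"
    using assms unfolding rich_def not_all not_imp by (elim exE conjE) (rule that)
  show thesis by (rule that[OF *(1)]) (use *(2) in blast)
qed

text \<open>
  If one colouring defeats \<open>A\<close> and another one defeats \<open>B\<close>, then their product defeats \<open>A \<union> B\<close>.
\<close>

lemma rich_Un:
  fixes A B :: "'a::comm_monoid_mult set"
  assumes "rich (A \<union> B)"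
  shows "rich A \<or> rich B"
proof (rule ccontr)
  assume neg: "\<not> (rich A \<or> rich B)"
  obtain X k L where X: "finite X"
    and A: "\<And>G. finite G \<Longrightarrow> \<exists>\<chi>. (\<forall>x. \<chi> x < k) \<and> \<not> mono_progression \<chi> G (A - X) L"
    by (rule not_richE[of A]) (use neg in blast)+
  obtain Y m M where Y: "finite Y"
    and B: "\<And>G. finite G \<Longrightarrow> \<exists>\<chi>. (\<forall>x. \<chi> x < m) \<and> \<not> mono_progression \<chi> G (B - Y) M"
    by (rule not_richE[of B]) (use neg in blast)+
  obtain G where G: "finite G"
    "\<And>\<chi>. (\<forall>x. \<chi> x < k * m) \<Longrightarrow> mono_progression \<chi> G (A \<union> B - (X \<union> Y)) (max L M)"
    using richD[OF assms, of "X \<union> Y" "k * m" "max L M"] X Y by blast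
  obtain \<chi> where \<chi>: "\<forall>x. \<chi> x < k" "\<not> mono_progression \<chi> G (A - X) L" using A[OF G(1)] by blast
  obtain \<psi> where \<psi>: "\<forall>x. \<psi> x < m" "\<not> mono_progression \<psi> G (B - Y) M" using B[OF G(1)] by blast
  define \<phi> where "\<phi> x = \<chi> x * m + \<psi> x" for x
  have "\<phi> x < k * m" for x
  proof -
    have "\<phi> x < Suc (\<chi> x) * m" using \<psi>(1) by (simp add: \<phi>_def)
    also have "\<dots> \<le> k * m" using \<chi>(1) by (intro mult_le_mono1) (simp add: Suc_leI)
    finally show ?thesis .
  qed
  then have "mono_progression \<phi> G (A \<union> B - (X \<union> Y)) (max L M)" using G(2) by blast
  then obtain a b where ab: "a \<in> G" "b \<in> G" "b \<in> A \<union> B - (X \<union> Y)"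
    "\<forall>l\<le>max L M. \<phi> (a * b ^ l) = \<phi> a" unfolding mono_progression_def by blast
  have dm: "\<phi> x div m = \<chi> x" "\<phi> x mod m = \<psi> x" for x
    using \<psi>(1)[rule_format, of x] by (simp_all add: \<phi>_def)
  have \<chi>': "\<forall>l\<le>L. \<chi> (a * b ^ l) = \<chi> a"
    unfolding dm(1)[symmetric] using ab(4) by simp
  have \<psi>': "\<forall>l\<le>M. \<psi> (a * b ^ l) = \<psi> a"
    unfolding dm(2)[symmetric] using ab(4) by simp
  show False
    using ab(1-3) \<chi>(2) \<psi>(2) \<chi>' \<psi>' unfolding mono_progression_def by blast
qed

lemma rich_UN:
  assumes "finite J" "rich (\<Union>j\<in>J. A j)"
  shows "\<exists>j\<in>J. rich (A j)"
  using assms by (induction J) (auto simp: not_rich_empty dest: rich_Un)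

text \<open>
  The progression with difference \<open>b ^ n\<close> consists of every \<open>n\<close>-th term of the one with
  difference \<open>b\<close>.  Root-finiteness keeps the set of forbidden differences finite.
\<close>

lemma rich_power_image:
  fixes A :: "'a::comm_monoid_mult set"
  assumes A: "rich A" and rf: "root_finite TYPE('a)" and n: "0 < n"
  shows "rich ((\<lambda>x. x ^ n) ` A)"
  unfolding rich_def
proof (intro allI impI)
  fix X :: "'a set" and k L :: nat
  assume X: "finite X"
  have "{x. x ^ n \<in> X} = (\<Union>y\<in>X. {x. x ^ n = y})" by auto
  then have "finite {x. x ^ n \<in> X}" using X rf n by (auto simp: root_finite_def)
  then obtain G where G: "finite G"
    "\<And>\<chi>. (\<forall>x. \<chi> x < k) \<Longrightarrow> mono_progression \<chi> G (A - {x. x ^ n \<in> X}) (n * L)"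
    using richD[OF A, of "{x. x ^ n \<in> X}" k "n * L"] by blast
  show "\<exists>G. finite G \<and> (\<forall>\<chi>. (\<forall>x. \<chi> x < k) \<longrightarrow> mono_progression \<chi> G ((\<lambda>x. x ^ n) ` A - X) L)"
  proof (intro exI[of _ "G \<union> (\<lambda>x. x ^ n) ` G"] conjI allI impI)
    show "finite (G \<union> (\<lambda>x. x ^ n) ` G)" using G(1) by simp
    fix \<chi> :: "'a \<Rightarrow> nat" assume "\<forall>x. \<chi> x < k"
    then have "mono_progression \<chi> G (A - {x. x ^ n \<in> X}) (n * L)" using G(2) by blast
    then obtain a b where ab: "a \<in> G" "b \<in> G" "b \<in> A" "b ^ n \<notin> X"
      "\<forall>l\<le>n * L. \<chi> (a * b ^ l) = \<chi> a" unfolding mono_progression_def by blast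
    have "\<forall>l\<le>L. \<chi> (a * (b ^ n) ^ l) = \<chi> a"
      using ab(5) by (simp add: power_mult[symmetric])
    then show "mono_progression \<chi> (G \<union> (\<lambda>x. x ^ n) ` G) ((\<lambda>x. x ^ n) ` A - X) L"
      using ab unfolding mono_progression_def by blast
  qed
qed

text \<open>
  The bound \<open>W\<close> is fixed first.  Then \<open>z\<close> is chosen such that \<open>z, \<dots>, z ^ W\<close> avoid the forbidden
  set, which root-finiteness allows for all but finitely many \<open>z\<close>; the progression is found
  among the powers of \<open>z\<close>, even if they are not distinct.
\<close>

lemma rich_UNIV:
  assumes inf: "infinite (UNIV :: 'a::comm_monoid_mult set)" and rf: "root_finite TYPE('a)"
  shows "rich (UNIV :: 'a set)"
  unfolding rich_def
proof (intro allI impI)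
  fix X :: "'a set" and k L :: nat
  assume X: "finite X"
  obtain W where W: "vdw_bound L k W" using van_der_Waerden by blast
  have "finite (\<Union>d\<in>{1..W}. \<Union>y\<in>X. {x::'a. x ^ d = y})"
    using X rf by (auto simp: root_finite_def)
  then obtain z :: 'a where z: "z \<notin> (\<Union>d\<in>{1..W}. \<Union>y\<in>X. {x. x ^ d = y})"
    using inf by (metis ex_new_if_finite)
  show "\<exists>G. finite G \<and> (\<forall>\<chi>. (\<forall>x. \<chi> x < k) \<longrightarrow> mono_progression \<chi> G (UNIV - X) L)"
  proof (intro exI[of _ "(\<lambda>n. z ^ n) ` {..W}"] conjI allI impI)
    fix \<chi> :: "'a \<Rightarrow> nat" assume "\<forall>x. \<chi> x < k"
    then obtain a d where d: "0 < d" "a + L * d \<le> W" "d \<le> W"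
      "\<forall>l\<le>L. \<chi> (z ^ (a + l * d)) = \<chi> (z ^ a)"
      using W[unfolded vdw_bound_def, rule_format, of "\<lambda>n. \<chi> (z ^ n)"] by blast
    have "\<forall>l\<le>L. \<chi> (z ^ a * (z ^ d) ^ l) = \<chi> (z ^ a)"
      using d(4) by (simp add: power_add power_mult[symmetric] mult.commute)
    moreover have "z ^ d \<notin> X" using z d by auto
    moreover have "a \<le> W" using d(2) by simp
    ultimately show "mono_progression \<chi> ((\<lambda>n. z ^ n) ` {..W}) (UNIV - X) L"
      using d(3) unfolding mono_progression_def by blast
  qed simp
qed

section \<open>Thick and piecewise syndetic sets for the exponential action\<close>

lemma exp_op_mult:
  "hom_to_pos_nat \<theta> \<Longrightarrow> exp_op \<theta> (x * y) z = exp_op \<theta> x (exp_op \<theta> y z)"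
  by (simp add: exp_op_def hom_to_pos_nat_def power_mult[symmetric] mult.commute)

lemma exp_op_one:
  assumes "hom_to_pos_nat \<theta>"
  shows "exp_op \<theta> 1 z = z"
proof -
  have "\<theta> 1 * \<theta> 1 = \<theta> 1" "0 < \<theta> 1"
    using assms unfolding hom_to_pos_nat_def by (metis mult_1, blast)
  then show ?thesis by (simp add: exp_op_def)
qed

text \<open>
  The usual notions for a monoid action, with ``nonempty'' replaced by ``rich''.
\<close>

definition thick :: "('a::comm_monoid_mult \<Rightarrow> nat) \<Rightarrow> 'a set \<Rightarrow> bool" where
  "thick \<theta> A \<longleftrightarrow> (\<forall>H. finite H \<longrightarrow> rich {z. \<forall>h\<in>H. exp_op \<theta> h z \<in> A})"

definition piecewise_syndetic :: "('a::comm_monoid_mult \<Rightarrow> nat) \<Rightarrow> 'a set \<Rightarrow> bool" where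
  "piecewise_syndetic \<theta> A \<longleftrightarrow> (\<exists>F. finite F \<and> thick \<theta> {z. \<exists>s\<in>F. exp_op \<theta> s z \<in> A})"

lemma piecewise_syndeticI:
  "finite F \<Longrightarrow> thick \<theta> {z. \<exists>s\<in>F. exp_op \<theta> s z \<in> A} \<Longrightarrow> piecewise_syndetic \<theta> A"
  unfolding piecewise_syndetic_def by (intro exI conjI)

lemma thickD:
  "thick \<theta> A \<Longrightarrow> finite H \<Longrightarrow> rich {z. \<forall>h\<in>H. exp_op \<theta> h z \<in> A}"
  by (simp add: thick_def)

lemma piecewise_syndeticE:
  assumes "piecewise_syndetic \<theta> A"
  obtains F where "finite F" "thick \<theta> {z. \<exists>s\<in>F. exp_op \<theta> s z \<in> A}"
  using assms unfolding piecewise_syndetic_def by (elim exE conjE) (rule that)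

lemma thick_mono:
  assumes "thick \<theta> A" "A \<subseteq> B"
  shows "thick \<theta> B"
  unfolding thick_def
proof (intro allI impI)
  fix H :: "'a set" assume "finite H"
  with assms(1) have "rich {z. \<forall>h\<in>H. exp_op \<theta> h z \<in> A}" by (rule thickD)
  then show "rich {z. \<forall>h\<in>H. exp_op \<theta> h z \<in> B}"
    by (rule rich_mono) (use assms(2) in blast)
qed

lemma not_thick_empty: "\<not> thick \<theta> {}"
proof
  assume "thick \<theta> {}"
  then have "rich {z. \<forall>h\<in>{1}. exp_op \<theta> h z \<in> {}}" by (rule thickD) simp
  then show False by (simp add: not_rich_empty)
qed

lemma thick_imp_rich:
  assumes "hom_to_pos_nat \<theta>" "thick \<theta> A"
  shows "rich A"
proof -
  have "rich {z. \<forall>h\<in>{1}. exp_op \<theta> h z \<in> A}"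
    by (rule thickD[OF assms(2)]) simp
  then show ?thesis using assms(1) by (simp add: exp_op_one)
qed

lemma thick_Inter_preimages:
  assumes hom: "hom_to_pos_nat \<theta>" and A: "thick \<theta> A" and "finite G"
  shows "thick \<theta> {z. \<forall>g\<in>G. exp_op \<theta> g z \<in> A}"
  unfolding thick_def
proof (intro allI impI)
  fix H :: "'a set" assume "finite H"
  then have "finite ((\<lambda>(g, h). g * h) ` (G \<times> H))" using \<open>finite G\<close> by simp
  then have "rich {z. \<forall>x\<in>(\<lambda>(g, h). g * h) ` (G \<times> H). exp_op \<theta> x z \<in> A}"
    by (rule thickD[OF A])
  then show "rich {z. \<forall>h\<in>H. exp_op \<theta> h z \<in> {z. \<forall>g\<in>G. exp_op \<theta> g z \<in> A}}"
    by (rule rich_mono) (auto simp: exp_op_mult[OF hom])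
qed

lemma rich_of_preimage:
  fixes \<theta> :: "'a::comm_monoid_mult \<Rightarrow> nat"
  assumes hom: "hom_to_pos_nat \<theta>" and rf: "root_finite TYPE('a)"
    and "rich {z. exp_op \<theta> s z \<in> A}"
  shows "rich A"
proof -
  have "rich ((\<lambda>z. z ^ \<theta> s) ` {z. exp_op \<theta> s z \<in> A})"
    using assms by (intro rich_power_image) (auto simp: hom_to_pos_nat_def)
  then show ?thesis by (rule rich_mono) (auto simp: exp_op_def)
qed

text \<open>
  If \<open>A\<close> is not piecewise syndetic, then the union of the preimages \<open>E\<^sub>h\<^sup>-\<^sup>1 A\<close> for \<open>h \<in> H\<close> is not thick,
  so for some finite \<open>K\<close> only a non-rich set of \<open>z\<close> has all \<open>E\<^sub>k z\<close> in that union.  By partition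
  regularity, a rich set of \<open>z\<close> remains for which some fixed \<open>E\<^sub>k z\<close> avoids all of
  these preimages.  The whole \<open>H\<close>-orbit of \<open>E\<^sub>k z\<close> then lies in \<open>B\<close>.
\<close>

lemma thick_Un:
  fixes \<theta> :: "'a::comm_monoid_mult \<Rightarrow> nat"
  assumes hom: "hom_to_pos_nat \<theta>" and rf: "root_finite TYPE('a)"
    and T: "thick \<theta> (A \<union> B)" and nA: "\<not> piecewise_syndetic \<theta> A"
  shows "thick \<theta> B"
  unfolding thick_def
proof (intro allI impI)
  fix H :: "'a set" assume H: "finite H"
  have "\<not> thick \<theta> {z. \<exists>h\<in>H. exp_op \<theta> h z \<in> A}"
    using nA piecewise_syndeticI[OF H] by (rule contrapos_nn)
  then obtain K where K: "finite K"
    "\<not> rich {z. \<forall>k\<in>K. exp_op \<theta> k z \<in> {z. \<exists>h\<in>H. exp_op \<theta> h z \<in> A}}" (is "\<not> rich ?U")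
    unfolding thick_def not_all not_imp by (elim exE conjE) (rule that)
  let ?G = "\<lambda>k. {z. exp_op \<theta> k z \<in> {z. \<forall>h\<in>H. exp_op \<theta> h z \<in> B}}"
  have "thick \<theta> {z. \<forall>h\<in>H. exp_op \<theta> h z \<in> A \<union> B}"
    using thick_Inter_preimages[OF hom T H] .
  then have "rich {z. \<forall>k\<in>K. exp_op \<theta> k z \<in> {z. \<forall>h\<in>H. exp_op \<theta> h z \<in> A \<union> B}}"
    using K(1) by (rule thickD)
  then have "rich (?U \<union> (\<Union>k\<in>K. ?G k))"
    by (rule rich_mono) blast
  then have "rich (\<Union>k\<in>K. ?G k)" using K(2) rich_Un by blast
  then obtain k where "rich (?G k)" using rich_UN[OF K(1)] by blast
  then show "rich {z. \<forall>h\<in>H. exp_op \<theta> h z \<in> B}"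
    by (rule rich_of_preimage[OF hom rf])
qed

lemma thick_UN:
  fixes \<theta> :: "'a::comm_monoid_mult \<Rightarrow> nat"
  assumes hom: "hom_to_pos_nat \<theta>" and rf: "root_finite TYPE('a)"
    and "finite J" "thick \<theta> (\<Union>j\<in>J. A j)"
  shows "\<exists>j\<in>J. piecewise_syndetic \<theta> (A j)"
  using assms(3,4)
proof (induction J)
  case empty
  then show ?case by (simp add: not_thick_empty)
next
  case (insert j J)
  then show ?case using thick_Un[OF hom rf, of "A j" "\<Union>j\<in>J. A j"] by auto
qed

lemma piecewise_syndetic_of_preimages:
  assumes hom: "hom_to_pos_nat \<theta>" and "finite F"
    and "piecewise_syndetic \<theta> {z. \<exists>s\<in>F. exp_op \<theta> s z \<in> A}"
  shows "piecewise_syndetic \<theta> A"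
proof -
  obtain E where E: "finite E" "thick \<theta> {z. \<exists>e\<in>E. exp_op \<theta> e z \<in> {z. \<exists>s\<in>F. exp_op \<theta> s z \<in> A}}"
    using assms(3) by (rule piecewise_syndeticE)
  have "thick \<theta> {z. \<exists>x\<in>(\<lambda>(s, e). s * e) ` (F \<times> E). exp_op \<theta> x z \<in> A}"
    using E(2) by (rule thick_mono) (force simp: exp_op_mult[OF hom])
  moreover have "finite ((\<lambda>(s, e). s * e) ` (F \<times> E))" using E(1) \<open>finite F\<close> by simp
  ultimately show ?thesis by (intro piecewise_syndeticI)
qed

lemma piecewise_syndetic_imp_rich:
  fixes \<theta> :: "'a::comm_monoid_mult \<Rightarrow> nat"
  assumes hom: "hom_to_pos_nat \<theta>" and rf: "root_finite TYPE('a)"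
    and "piecewise_syndetic \<theta> A"
  shows "rich A"
proof -
  obtain F where F: "finite F" "thick \<theta> {z. \<exists>s\<in>F. exp_op \<theta> s z \<in> A}"
    using assms(3) by (rule piecewise_syndeticE)
  have "{z. \<exists>s\<in>F. exp_op \<theta> s z \<in> A} = (\<Union>s\<in>F. {z. exp_op \<theta> s z \<in> A})" by auto
  then have "\<exists>s\<in>F. rich {z. exp_op \<theta> s z \<in> A}"
    using thick_imp_rich[OF hom F(2)] rich_UN[OF F(1)] by simp
  then show ?thesis using rich_of_preimage[OF hom rf] by blast
qed

section \<open>Multiple recurrence and the construction of the sequence\<close>

text \<open>
  Let \<open>T = \<Union>s\<in>F. E\<^sub>s\<^sup>-\<^sup>1 A\<close> be thick.  As \<open>A\<close> is rich, there is a finite set \<open>G\<close> in which every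
  \<open>F\<close>-colouring has a monochromatic progression with difference \<open>b \<in> G \<inter> (A - X)\<close>.  If \<open>E\<^sub>g z \<in> T\<close> for
  all points \<open>g\<close> of these progressions, colour \<open>g\<close> by an \<open>s\<close> with \<open>E\<^sub>s E\<^sub>g z \<in> A\<close>.  A monochromatic
  progression says that \<open>E\<^bsub>sa\<^esub> z\<close> lies in the set \<open>{z. \<forall>l \<le> L. E\<^bsub>b^l\<^esub> z \<in> A}\<close>.  Thus a thick set is covered
  by finitely many sets of preimages, one for each \<open>b\<close>, and one of them is piecewise syndetic.
\<close>

lemma piecewise_syndetic_recurrence:
  fixes \<theta> :: "'a::comm_monoid_mult \<Rightarrow> nat"
  assumes hom: "hom_to_pos_nat \<theta>" and rf: "root_finite TYPE('a)"
    and A: "piecewise_syndetic \<theta> A" and X: "finite X"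
  shows "\<exists>b\<in>A - X. piecewise_syndetic \<theta> {z. \<forall>l\<le>L. exp_op \<theta> (b ^ l) z \<in> A}"
proof -
  obtain F where F: "finite F" "thick \<theta> {z. \<exists>s\<in>F. exp_op \<theta> s z \<in> A}" (is "thick \<theta> ?T")
    using A by (rule piecewise_syndeticE)
  obtain h :: "'a \<Rightarrow> nat" where h: "bij_betw h F {0..<card F}"
    using ex_bij_betw_finite_nat[OF F(1)] by blast
  have "F \<noteq> {}" using F(2) by (auto simp: not_thick_empty)
  then obtain s0 where s0: "s0 \<in> F" by blast
  obtain G where G: "finite G"
    "\<And>\<chi>. (\<forall>x. \<chi> x < card F) \<Longrightarrow> mono_progression \<chi> G (A - X) L"
    using richD[OF piecewise_syndetic_imp_rich[OF hom rf A] X, of "card F" L] by blast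
  let ?P = "(\<lambda>(a, b, l). a * b ^ l) ` (G \<times> G \<times> {..L})"
  let ?R = "\<lambda>b. {z. \<forall>l\<le>L. exp_op \<theta> (b ^ l) z \<in> A}"
  let ?F = "(\<lambda>(s, a). s * a) ` (F \<times> G)"
  let ?B = "\<lambda>b. {z. \<exists>x\<in>?F. exp_op \<theta> x z \<in> ?R b}"
  have "thick \<theta> {z. \<forall>g\<in>?P. exp_op \<theta> g z \<in> ?T}"
    by (rule thick_Inter_preimages[OF hom F(2)]) (use G(1) in simp)
  moreover have "{z. \<forall>g\<in>?P. exp_op \<theta> g z \<in> ?T} \<subseteq> (\<Union>b\<in>G \<inter> (A - X). ?B b)"
  proof
    fix z assume "z \<in> {z. \<forall>g\<in>?P. exp_op \<theta> g z \<in> ?T}"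
    then have z: "\<exists>s\<in>F. exp_op \<theta> s (exp_op \<theta> (a * b ^ l) z) \<in> A"
      if "a \<in> G" "b \<in> G" "l \<le> L" for a b l
      using that by force
    \<comment> \<open>Colour \<open>g\<close> by some \<open>s \<in> F\<close> that carries \<open>exp_op \<theta> g z\<close> into \<open>A\<close>; the value \<open>s0\<close>
      outside the finitely many relevant \<open>g\<close> only makes the colouring total.\<close>
    define \<sigma> where "\<sigma> g = (if \<exists>s\<in>F. exp_op \<theta> s (exp_op \<theta> g z) \<in> A
       then SOME s. s \<in> F \<and> exp_op \<theta> s (exp_op \<theta> g z) \<in> A else s0)" for g
    have \<sigma>: "\<sigma> g \<in> F \<and> exp_op \<theta> (\<sigma> g) (exp_op \<theta> g z) \<in> A"
      if "\<exists>s\<in>F. exp_op \<theta> s (exp_op \<theta> g z) \<in> A" for g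
      using that someI_ex[of "\<lambda>s. s \<in> F \<and> exp_op \<theta> s (exp_op \<theta> g z) \<in> A"]
      by (auto simp: \<sigma>_def)
    have \<sigma>F: "\<sigma> g \<in> F" for g
      using \<sigma>[of g] s0 by (cases "\<exists>s\<in>F. exp_op \<theta> s (exp_op \<theta> g z) \<in> A") (auto simp: \<sigma>_def)
    have "\<forall>g. h (\<sigma> g) < card F" using \<sigma>F bij_betwE[OF h] by auto
    then have "mono_progression (\<lambda>g. h (\<sigma> g)) G (A - X) L" by (rule G(2))
    then obtain a b where ab: "a \<in> G" "b \<in> G" "b \<in> A - X"
      "\<And>l. l \<le> L \<Longrightarrow> h (\<sigma> (a * b ^ l)) = h (\<sigma> a)"
      unfolding mono_progression_def by blast
    have "exp_op \<theta> (b ^ l) (exp_op \<theta> (\<sigma> a * a) z) \<in> A" if l: "l \<le> L" for l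
    proof -
      have "\<sigma> (a * b ^ l) = \<sigma> a"
        using inj_onD[OF bij_betw_imp_inj_on[OF h] ab(4)[OF l] \<sigma>F \<sigma>F] .
      then have "exp_op \<theta> (\<sigma> a) (exp_op \<theta> (a * b ^ l) z) \<in> A"
        using \<sigma>[OF z[OF ab(1,2) l]] by simp
      then show ?thesis
        by (simp add: exp_op_mult[OF hom, symmetric] mult_ac)
    qed
    then have "z \<in> ?B b" using \<sigma>F ab(1) by (auto intro!: bexI[of _ "(\<sigma> a, a)"])
    then show "z \<in> (\<Union>b\<in>G \<inter> (A - X). ?B b)" using ab by blast
  qed
  ultimately have "thick \<theta> (\<Union>b\<in>G \<inter> (A - X). ?B b)" by (rule thick_mono)
  then obtain b where b: "b \<in> G \<inter> (A - X)" "piecewise_syndetic \<theta> (?B b)"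
    using thick_UN[OF hom rf, of "G \<inter> (A - X)" ?B] G(1) by blast
  have "piecewise_syndetic \<theta> (?R b)"
    by (rule piecewise_syndetic_of_preimages[OF hom _ b(2)]) (use F(1) G(1) in simp)
  then show ?thesis using b(1) by blast
qed

text \<open>
  Recurrence is iterated.  The list of the terms chosen so far is part of the state for two
  reasons: \<open>\<beta>\<close> computes the next exponent bound from it, and the next term has to avoid it.
\<close>

lemma recurrent_sequence:
  fixes \<theta> :: "'a::comm_monoid_mult \<Rightarrow> nat" and \<beta> :: "'a list \<Rightarrow> nat"
  assumes hom: "hom_to_pos_nat \<theta>" and rf: "root_finite TYPE('a)"
    and C: "piecewise_syndetic \<theta> C"
  shows "\<exists>(a :: nat \<Rightarrow> 'a) A. inj a \<and> A 0 = C \<and> (\<forall>n. a n \<in> A n \<and>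
    A (Suc n) = {z. \<forall>l\<le>\<beta> (map a [0..<n]). exp_op \<theta> (a n ^ l) z \<in> A n})"
proof -
  define Good where "Good = (\<lambda>(n::nat) (xs :: 'a list, B). length xs = n \<and> piecewise_syndetic \<theta> B \<and> (n = 0 \<longrightarrow> B = C))"
  define Step where "Step = (\<lambda>(_::nat) (xs, B) (ys, B').
    \<exists>b. b \<in> B - set xs \<and> ys = xs @ [b] \<and> B' = {z. \<forall>l\<le>\<beta> xs. exp_op \<theta> (b ^ l) z \<in> B})"
  have "\<exists>s. \<forall>n. Good n (s n) \<and> Step n (s n) (s (Suc n))"
  proof (rule dependent_nat_choice)
    show "\<exists>s. Good 0 s" using C by (auto simp: Good_def)
  next
    fix s n assume s: "Good n s"
    obtain xs B where xs: "s = (xs, B)" by (cases s)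
    obtain b where "b \<in> B - set xs" "piecewise_syndetic \<theta> {z. \<forall>l\<le>\<beta> xs. exp_op \<theta> (b ^ l) z \<in> B}"
      using piecewise_syndetic_recurrence[OF hom rf, of B "set xs" "\<beta> xs"] s
      by (auto simp: Good_def xs)
    then show "\<exists>t. Good (Suc n) t \<and> Step n s t"
      using s
      by (intro exI[of _ "(xs @ [b], {z. \<forall>l\<le>\<beta> xs. exp_op \<theta> (b ^ l) z \<in> B})"])
        (auto simp: Good_def Step_def xs)
  qed
  then obtain s where s: "\<And>n. Good n (s n)" "\<And>n. Step n (s n) (s (Suc n))" by blast
  define a where "a n = last (fst (s (Suc n)))" for n
  define A where "A n = snd (s n)" for n
  have step: "a n \<in> A n - set (fst (s n))" "fst (s (Suc n)) = fst (s n) @ [a n]"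
    "A (Suc n) = {z. \<forall>l\<le>\<beta> (fst (s n)). exp_op \<theta> (a n ^ l) z \<in> A n}" for n
    using s(2)[of n] by (auto simp: Step_def a_def A_def split: prod.splits)
  have pref: "fst (s n) = map a [0..<n]" for n
  proof (induction n)
    case 0
    show ?case using s(1)[of 0] by (auto simp: Good_def split: prod.splits)
  next
    case (Suc n)
    then show ?case by (simp add: step(2))
  qed
  have "a m \<noteq> a n" if "m < n" for m n
  proof -
    have "a m \<in> set (map a [0..<n])" using that by simp
    moreover have "a n \<notin> set (map a [0..<n])" using step(1)[of n] unfolding pref by simp
    ultimately show ?thesis by metis
  qed
  then have "inj a" by (metis injI linorder_neqE_nat)
  moreover have "A 0 = C" using s(1)[of 0] by (auto simp: Good_def A_def split: prod.splits)
  moreover have "\<forall>n. a n \<in> A n \<and>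
      A (Suc n) = {z. \<forall>l\<le>\<beta> (map a [0..<n]). exp_op \<theta> (a n ^ l) z \<in> A n}"
    using step pref by simp
  ultimately show ?thesis by (intro exI conjI)
qed

theorem theorem3p18:
  fixes \<theta> :: "'a::comm_monoid_mult \<Rightarrow> nat"
    and C :: "nat \<Rightarrow> 'a set" and r N :: nat
    and f :: "nat \<Rightarrow> 'a list \<Rightarrow> nat"
  assumes "infinite (UNIV :: 'a set)"
    and "weakly_cancellative ((*) :: 'a \<Rightarrow> 'a \<Rightarrow> 'a)"
    and "root_finite TYPE('a)"
    and "hom_to_pos_nat \<theta>"
    and "(\<Union>i\<in>{1..r}. C i) = UNIV" and "disjoint_family_on C {1..r}"
    and "N > 0"
    and "\<And>n xs. n \<ge> 2 \<Longrightarrow> length xs = n - 1 \<Longrightarrow> f n xs > 0"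
  shows "\<exists>(a :: nat \<Rightarrow> 'a) i. inj_on a {1..} \<and> i \<in> {1..r} \<and> FE \<theta> N f a \<subseteq> C i"
proof -
  note hom = assms(4) and rf = assms(3)
  have "thick \<theta> (UNIV :: 'a set)"
    using rich_UNIV[OF assms(1) rf] by (simp add: thick_def)
  then have "thick \<theta> (\<Union>i\<in>{1..r}. C i)" using assms(5) by simp
  then have "\<exists>i\<in>{1..r}. piecewise_syndetic \<theta> (C i)"
    by (rule thick_UN[OF hom rf finite_atLeastAtMost])
  then obtain i where i: "i \<in> {1..r}" "piecewise_syndetic \<theta> (C i)" ..
  define \<beta> where "\<beta> xs = (if xs = [] then N else f (Suc (length xs)) xs)" for xs
  obtain b A where seq: "inj b \<and> A 0 = C i \<and> (\<forall>n. b n \<in> A n \<and>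
      A (Suc n) = {z. \<forall>l\<le>\<beta> (map b [0..<n]). exp_op \<theta> (b n ^ l) z \<in> A n})"
    using recurrent_sequence[OF hom rf i(2), of \<beta>] by (elim exE) (rule that)
  then have inj: "inj b" and A0: "A 0 = C i" and bA: "b n \<in> A n"
    and A: "A (Suc n) = {z. \<forall>l\<le>\<beta> (map b [0..<n]). exp_op \<theta> (b n ^ l) z \<in> A n}" for n
    by simp_all
  define a where "a n = b (n - 1)" for n
  have shift: "map a [1..<Suc n] = map b [0..<n]" for n
    by (induction n) (simp_all add: a_def)
  \<comment> \<open>\<open>A n\<close> consists of points that all admissible products of the first \<open>n\<close> terms carry into the
    colour: peel off the factor with the largest index, which leads from \<open>A (Suc n)\<close> to \<open>A n\<close>.\<close>
  have main: "exp_op \<theta> (\<Prod>t=1..n. a t ^ l t) z \<in> C i"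
    if "z \<in> A n" "l 1 \<le> N" "\<forall>t\<in>{2..n}. l t \<le> f t (map a [1..<t])" for n z l
    using that
  proof (induction n arbitrary: z)
    case 0
    then show ?case by (simp add: A0 exp_op_one[OF hom])
  next
    case (Suc n)
    have "l (Suc n) \<le> \<beta> (map b [0..<n])"
    proof (cases "n = 0")
      case True
      then show ?thesis using Suc.prems(2) by (simp add: \<beta>_def)
    next
      case False
      then have "Suc n \<in> {2..Suc n}" by simp
      then have "l (Suc n) \<le> f (Suc n) (map a [1..<Suc n])" by (rule Suc.prems(3)[rule_format])
      then show ?thesis using False unfolding shift by (simp add: \<beta>_def)
    qed
    then have "exp_op \<theta> (b n ^ l (Suc n)) z \<in> A n" using Suc.prems(1) by (simp add: A)
    then have "exp_op \<theta> (\<Prod>t=1..n. a t ^ l t) (exp_op \<theta> (a (Suc n) ^ l (Suc n)) z) \<in> C i"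
      using Suc.IH Suc.prems(2,3) by (simp add: a_def)
    then show ?case by (simp add: exp_op_mult[OF hom])
  qed
  have "EXP \<theta> N f a k \<subseteq> C i" if "k \<ge> 1" for k
  proof (cases "k = 1")
    case True
    then show ?thesis using bA[of 0] by (simp add: EXP_def a_def A0)
  next
    case False
    have "a k \<in> A (k - 1)" using bA by (simp add: a_def)
    then show ?thesis using False main[of "a k" "k - 1"] by (auto simp: EXP_def)
  qed
  then have "FE \<theta> N f a \<subseteq> C i" unfolding FE_def by auto
  moreover have "inj_on a {1..}"
  proof (rule inj_onI)
    fix m n assume "m \<in> {1..}" "n \<in> {1..}" "a m = a n"
    then show "m = n" using injD[OF inj, of "m - 1" "n - 1"] by (simp add: a_def)
  qed
  ultimately show ?thesis using i(1) by blast
qed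

end
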